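(* Every minimal cover of a Latin square of order $n$ has size at most $\lfloor 3(n+1/2 - \sqrt{n+1/4})\rfloor$.
   Context: A Latin square of order $n$ is an $n\times n$ array on $n$ symbols in which each symbol occurs once in each row and each column; its entries are the triples $(i,j,L_{ij})$. A line is the set of all entries in a given row, in a given column, or with a given symbol. A cover is a set of entries meeting every line. A cover $\mathscr{C}$ is minimal if for every entry $\mathbf{e}\in\mathscr{C}$ the set $\mathscr{C}\setminus\{\mathbf{e}\}$ is not a cover. *)

theory Defs
  imports Complex_Main
begin

text \<open>Rows and columns are indexed by \<open>{1..n}\<close>; the symbols form an arbitrary set \<open>S\<close> with
  \<open>n\<close> elements.  Values of \<open>L\<close> outside \<open>{1..n} \<times> {1..n}\<close> are irrelevant.\<close>

definition latin_square :: "nat \<Rightarrow> 's set \<Rightarrow> (nat \<Rightarrow> nat \<Rightarrow> 's) \<Rightarrow> bool" where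
  "latin_square n S L \<longleftrightarrow>
     finite S \<and> card S = n \<and>
     (\<forall>i\<in>{1..n}. \<forall>j\<in>{1..n}. L i j \<in> S) \<and>
     (\<forall>s\<in>S. \<forall>i\<in>{1..n}. \<exists>!j. j \<in> {1..n} \<and> L i j = s) \<and>
     (\<forall>s\<in>S. \<forall>j\<in>{1..n}. \<exists>!i. i \<in> {1..n} \<and> L i j = s)"

definition entries :: "nat \<Rightarrow> (nat \<Rightarrow> nat \<Rightarrow> 's) \<Rightarrow> (nat \<times> nat \<times> 's) set" where
  "entries n L = {(i, j, L i j) | i j. i \<in> {1..n} \<and> j \<in> {1..n}}"

definition row_line :: "nat \<Rightarrow> (nat \<Rightarrow> nat \<Rightarrow> 's) \<Rightarrow> nat \<Rightarrow> (nat \<times> nat \<times> 's) set" where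
  "row_line n L r = {(i, j, s) \<in> entries n L. i = r}"

definition column_line :: "nat \<Rightarrow> (nat \<Rightarrow> nat \<Rightarrow> 's) \<Rightarrow> nat \<Rightarrow> (nat \<times> nat \<times> 's) set" where
  "column_line n L c = {(i, j, s) \<in> entries n L. j = c}"

definition symbol_line :: "nat \<Rightarrow> (nat \<Rightarrow> nat \<Rightarrow> 's) \<Rightarrow> 's \<Rightarrow> (nat \<times> nat \<times> 's) set" where
  "symbol_line n L t = {(i, j, s) \<in> entries n L. s = t}"

definition lines :: "nat \<Rightarrow> 's set \<Rightarrow> (nat \<Rightarrow> nat \<Rightarrow> 's) \<Rightarrow> (nat \<times> nat \<times> 's) set set" where
  "lines n S L = row_line n L ` {1..n} \<union> column_line n L ` {1..n} \<union> symbol_line n L ` S"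

definition is_cover ::
  "nat \<Rightarrow> 's set \<Rightarrow> (nat \<Rightarrow> nat \<Rightarrow> 's) \<Rightarrow> (nat \<times> nat \<times> 's) set \<Rightarrow> bool" where
  "is_cover n S L C \<longleftrightarrow> C \<subseteq> entries n L \<and> (\<forall>l\<in>lines n S L. C \<inter> l \<noteq> {})"

definition is_minimal_cover ::
  "nat \<Rightarrow> 's set \<Rightarrow> (nat \<Rightarrow> nat \<Rightarrow> 's) \<Rightarrow> (nat \<times> nat \<times> 's) set \<Rightarrow> bool" where
  "is_minimal_cover n S L C \<longleftrightarrow> is_cover n S L C \<and> (\<forall>e\<in>C. \<not> is_cover n S L (C - {e}))"

end

theory Submission
  imports Defs
begin

text \<open>By minimality every entry of the cover is the only one on some line. Assign to each entry one
  such line, and let \<open>a\<close>, \<open>b\<close>, \<open>c\<close> be the numbers of entries that are assigned a row, a column and a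
  symbol. An entry that is assigned a row lies on no assigned column and on no assigned symbol, and
  it is determined by its column and its symbol; hence \<open>a \<le> (n - b) (n - c)\<close>, and
  likewise for \<open>b\<close> and \<open>c\<close>. With \<open>D = 3 n - (a + b + c)\<close>, adding up the three inequalities gives
  \<open>3 n \<le> D + D\<^sup>2 / 3\<close>.\<close>

lemma inj_on_private:
  assumes "V \<subseteq> E" and "\<And>e f. e \<in> V \<Longrightarrow> f \<in> E \<Longrightarrow> h f = h e \<Longrightarrow> f = e"
  shows "inj_on h V"
proof (rule inj_onI)
  fix e f assume "e \<in> V" "f \<in> V" "h e = h f"
  then show "e = f" using assms(2)[of f e] assms(1) by blast
qed

text \<open>Counts the unassigned lines of one kind: \<open>h\<close> reads off the row, column or
  symbol of an entry, \<open>W\<close> indexes all lines of that kind, and \<open>V\<close> holds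
  the entries assigned such a line, each alone in \<open>E\<close> on it.\<close>

lemma card_Diff_private_image:
  assumes "finite W" "h ` E \<subseteq> W" "V \<subseteq> E"
    and "\<And>e f. e \<in> V \<Longrightarrow> f \<in> E \<Longrightarrow> h f = h e \<Longrightarrow> f = e"
  shows "real (card (W - h ` V)) = real (card W) - real (card V)"
proof -
  have s: "h ` V \<subseteq> W" using assms(2,3) by blast
  have "inj_on h V" using assms(3,4) by (rule inj_on_private)
  then have "card (h ` V) = card V" by (rule card_image)
  moreover have "card (h ` V) \<le> card W" using s assms(1) card_mono by blast
  moreover have "card (W - h ` V) = card W - card (h ` V)"
    using s assms(1) by (meson card_Diff_subset finite_subset)
  ultimately show ?thesis by simp
qed

text \<open>An assigned line contains no entry of \<open>E\<close> but its own, which lies in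
  \<open>B\<close> or \<open>G\<close> and so not in \<open>A\<close>. The coordinates
  \<open>p\<close>, \<open>q\<close> are left abstract so that one argument serves rows, columns and
  symbols in turn.\<close>

lemma card_le_unassigned_product:
  fixes p :: "'e \<Rightarrow> 'a" and q :: "'e \<Rightarrow> 'b"
  assumes fin: "finite Y" "finite Z"
    and sub: "A \<subseteq> E" "B \<subseteq> E" "G \<subseteq> E" "A \<inter> B = {}" "A \<inter> G = {}"
    and img: "p ` E \<subseteq> Y" "q ` E \<subseteq> Z"
    and B: "\<And>e f. e \<in> B \<Longrightarrow> f \<in> E \<Longrightarrow> p f = p e \<Longrightarrow> f = e"
    and G: "\<And>e f. e \<in> G \<Longrightarrow> f \<in> E \<Longrightarrow> q f = q e \<Longrightarrow> f = e"
    and inj: "inj_on (\<lambda>e. (p e, q e)) E"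
  shows "real (card A) \<le> (real (card Y) - real (card B)) * (real (card Z) - real (card G))"
proof -
  have "(\<lambda>e. (p e, q e)) ` A \<subseteq> (Y - p ` B) \<times> (Z - q ` G)"
  proof (rule image_subsetI)
    fix e assume e: "e \<in> A"
    then have "e \<in> E" "e \<notin> B" "e \<notin> G" using sub by auto
    then show "(p e, q e) \<in> (Y - p ` B) \<times> (Z - q ` G)"
      using img B G by blast
  qed
  then have "card A \<le> card ((Y - p ` B) \<times> (Z - q ` G))"
    using fin by (intro card_inj_on_le[OF inj_on_subset[OF inj sub(1)]]) auto
  then have "real (card A) \<le> real (card (Y - p ` B)) * real (card (Z - q ` G))"
    by (simp add: card_cartesian_product flip: of_nat_mult)
  also have "\<dots> = (real (card Y) - real (card B)) * (real (card Z) - real (card G))"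
    by (simp only: card_Diff_private_image[OF fin(1) img(1) sub(2) B]
        card_Diff_private_image[OF fin(2) img(2) sub(3) G])
  finally show ?thesis .
qed

lemma sum_le_of_cyclic_products:
  fixes a b c n :: real
  assumes "a \<le> (n - b) * (n - c)" "b \<le> (n - a) * (n - c)" "c \<le> (n - a) * (n - b)"
    and "a + b + c \<le> 3 * n"
  shows "a + b + c \<le> 3 * (n + 1 / 2 - sqrt (n + 1 / 4))"
proof -
  define D where "D = 3 * n - (a + b + c)"
  \<comment> \<open>With \<open>x = n - a\<close>, \<open>y = n - b\<close>,
    \<open>z = n - c\<close> we have \<open>D = x + y + z\<close>, and
    \<open>D\<^sup>2 - 3 * (x*y + y*z + z*x)\<close> is half the sum of the squares of the pairwise
    differences.\<close>
  have "3 * ((n - b) * (n - c) + (n - a) * (n - c) + (n - a) * (n - b)) \<le> D\<^sup>2"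
    using sum_squares_ge_zero[of "a - b" "b - c"] zero_le_square[of "a - c"]
    unfolding D_def by (simp add: power2_eq_square algebra_simps)
  moreover have "3 * n - D \<le> (n - b) * (n - c) + (n - a) * (n - c) + (n - a) * (n - b)"
    using add_mono[OF add_mono[OF assms(1,2)] assms(3)] unfolding D_def by simp
  ultimately have "3 * (3 * n - D) \<le> D\<^sup>2"
    by (meson mult_left_mono order_trans zero_le_numeral)
  \<comment> \<open>Divide by 9 and complete the square in \<open>D / 3\<close>; this is the source
    of the 1/4 and the 1/2 in the bound.\<close>
  then have "n + 1 / 4 \<le> (D / 3 + 1 / 2)\<^sup>2"
    by (simp add: power2_eq_square algebra_simps)
  moreover have "0 \<le> D / 3 + 1 / 2" using assms(4) unfolding D_def by simp
  ultimately have "sqrt (n + 1 / 4) \<le> D / 3 + 1 / 2" by (rule real_le_lsqrt[rotated])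
  then show ?thesis unfolding D_def by (simp add: field_simps)
qed

lemma finite_entries: "finite (entries n L)"
proof (rule finite_subset)
  show "entries n L \<subseteq> (\<lambda>(i, j). (i, j, L i j)) ` ({1..n} \<times> {1..n})"
    unfolding entries_def by auto
qed auto

text \<open>Removing \<open>e\<close> leaves some line unmet, so \<open>e\<close> is the only entry
  of \<open>C\<close> on that line. The three disjuncts are the three kinds of line, phrased by
  coordinates.\<close>

lemma minimal_cover_private_line:
  assumes "is_minimal_cover n S L C" "e \<in> C"
  shows "(\<forall>f\<in>C. fst f = fst e \<longrightarrow> f = e) \<or> (\<forall>f\<in>C. fst (snd f) = fst (snd e) \<longrightarrow> f = e) \<or>
    (\<forall>f\<in>C. snd (snd f) = snd (snd e) \<longrightarrow> f = e)"
proof -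
  have cov: "C \<subseteq> entries n L" "\<And>l. l \<in> lines n S L \<Longrightarrow> C \<inter> l \<noteq> {}"
    and "\<not> is_cover n S L (C - {e})"
    using assms unfolding is_minimal_cover_def is_cover_def by auto
  then obtain l where l: "l \<in> lines n S L" "(C - {e}) \<inter> l = {}"
    unfolding is_cover_def by blast
  then have el: "e \<in> l" and only: "\<And>f. f \<in> C \<Longrightarrow> f \<in> l \<Longrightarrow> f = e"
    using cov(2) by blast+
  from l(1) consider r where "l = row_line n L r" | r where "l = column_line n L r"
    | s where "l = symbol_line n L s"
    unfolding lines_def by blast
  then show ?thesis
  proof cases
    case 1
    then have "f \<in> l" if "f \<in> C" "fst f = fst e" for f
      using that el cov(1) unfolding row_line_def by (auto simp: split_beta)
    then show ?thesis using only by blast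
  next
    case 2
    then have "f \<in> l" if "f \<in> C" "fst (snd f) = fst (snd e)" for f
      using that el cov(1) unfolding column_line_def by (auto simp: split_beta)
    then show ?thesis using only by blast
  next
    case 3
    then have "f \<in> l" if "f \<in> C" "snd (snd f) = snd (snd e)" for f
      using that el cov(1) unfolding symbol_line_def by (auto simp: split_beta)
    then show ?thesis using only by blast
  qed
qed

theorem theorem3p3:
  fixes n :: nat and S :: "'s set" and L :: "nat \<Rightarrow> nat \<Rightarrow> 's"
    and C :: "(nat \<times> nat \<times> 's) set"
  assumes "latin_square n S L"
    and "is_minimal_cover n S L C"
  shows "int (card C) \<le> \<lfloor>3 * (real n + 1 / 2 - sqrt (real n + 1 / 4))\<rfloor>"
proof -
  let ?row = "fst :: nat \<times> nat \<times> 's \<Rightarrow> nat"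
  let ?col = "\<lambda>e :: nat \<times> nat \<times> 's. fst (snd e)"
  let ?sym = "\<lambda>e :: nat \<times> nat \<times> 's. snd (snd e)"
  have CE: "C \<subseteq> entries n L"
    using assms(2) unfolding is_minimal_cover_def is_cover_def by blast
  then have finC: "finite C" using finite_entries finite_subset by blast
  have S: "finite S" "card S = n" and LS: "\<And>i j. i \<in> {1..n} \<Longrightarrow> j \<in> {1..n} \<Longrightarrow> L i j \<in> S"
    and Lrow: "\<And>s i. s \<in> S \<Longrightarrow> i \<in> {1..n} \<Longrightarrow> \<exists>!j. j \<in> {1..n} \<and> L i j = s"
    and Lcol: "\<And>s j. s \<in> S \<Longrightarrow> j \<in> {1..n} \<Longrightarrow> \<exists>!i. i \<in> {1..n} \<and> L i j = s"
    using assms(1) unfolding latin_square_def by auto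
  have ent: "?row e \<in> {1..n}" "?col e \<in> {1..n}" "?sym e = L (?row e) (?col e)"
    if "e \<in> C" for e
    using that CE unfolding entries_def by auto
  have img: "?row ` C \<subseteq> {1..n}" "?col ` C \<subseteq> {1..n}" "?sym ` C \<subseteq> S"
    using ent LS by (simp_all add: image_subset_iff)
  \<comment> \<open>In a Latin square any two coordinates of an entry determine the third.\<close>
  have inj: "inj_on (\<lambda>e. (?col e, ?sym e)) C" "inj_on (\<lambda>e. (?row e, ?sym e)) C"
    "inj_on (\<lambda>e. (?row e, ?col e)) C"
  proof -
    show "inj_on (\<lambda>e. (?col e, ?sym e)) C"
    proof (rule inj_onI)
      fix e f assume h: "e \<in> C" "f \<in> C" "(?col e, ?sym e) = (?col f, ?sym f)"
      then have "?row e = ?row f"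
        using Lcol[of "?sym e" "?col e"] ent[of e] ent[of f] LS by auto
      then show "e = f" using h by (simp add: prod_eq_iff)
    qed
    show "inj_on (\<lambda>e. (?row e, ?sym e)) C"
    proof (rule inj_onI)
      fix e f assume h: "e \<in> C" "f \<in> C" "(?row e, ?sym e) = (?row f, ?sym f)"
      then have "?col e = ?col f"
        using Lrow[of "?sym e" "?row e"] ent[of e] ent[of f] LS by auto
      then show "e = f" using h by (simp add: prod_eq_iff)
    qed
    show "inj_on (\<lambda>e. (?row e, ?col e)) C"
      by (rule inj_onI) (simp add: prod_eq_iff ent(3))
  qed
  \<comment> \<open>An entry may be alone on several lines. Preferring rows, then columns, then
    symbols makes the assignment unique, so that \<open>A\<close>, \<open>B\<close>,
    \<open>G\<close> partition \<open>C\<close>.\<close>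
  define A where "A = {e \<in> C. \<forall>f\<in>C. ?row f = ?row e \<longrightarrow> f = e}"
  define B where "B = {e \<in> C - A. \<forall>f\<in>C. ?col f = ?col e \<longrightarrow> f = e}"
  define G where "G = C - A - B"
  have sub: "A \<subseteq> C" "B \<subseteq> C" "G \<subseteq> C"
    and disj: "A \<inter> B = {}" "A \<inter> G = {}" "B \<inter> A = {}" "B \<inter> G = {}" "G \<inter> A = {}" "G \<inter> B = {}"
    unfolding A_def B_def G_def by blast+
  have uA: "\<And>e f. e \<in> A \<Longrightarrow> f \<in> C \<Longrightarrow> ?row f = ?row e \<Longrightarrow> f = e"
    unfolding A_def by blast
  have uB: "\<And>e f. e \<in> B \<Longrightarrow> f \<in> C \<Longrightarrow> ?col f = ?col e \<Longrightarrow> f = e"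
    unfolding B_def by blast
  have uG: "\<And>e f. e \<in> G \<Longrightarrow> f \<in> C \<Longrightarrow> ?sym f = ?sym e \<Longrightarrow> f = e"
  proof -
    fix e f assume e: "e \<in> G" and f: "f \<in> C" "?sym f = ?sym e"
    have eC: "e \<in> C" "e \<notin> A" "e \<notin> B" using e unfolding G_def by simp_all
    \<comment> \<open>Being left over, \<open>e\<close> is alone neither in its row nor in its
      column, so its private line must be its symbol.\<close>
    have "\<not> (\<forall>f\<in>C. ?row f = ?row e \<longrightarrow> f = e)"
      using eC(1,2) unfolding A_def by simp
    moreover have "\<not> (\<forall>f\<in>C. ?col f = ?col e \<longrightarrow> f = e)"
      using eC unfolding B_def by simp
    ultimately have "\<forall>f\<in>C. ?sym f = ?sym e \<longrightarrow> f = e"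
      using minimal_cover_private_line[OF assms(2) eC(1)] by satx
    then show "f = e" using f by simp
  qed
  have "real (card A) \<le> (real n - real (card B)) * (real n - real (card G))"
    using card_le_unassigned_product[OF finite_atLeastAtMost S(1) sub(1,2,3) disj(1,2)
        img(2,3) uB uG inj(1)]
    by (simp only: S(2) card_atLeastAtMost diff_Suc_1)
  moreover have "real (card B) \<le> (real n - real (card A)) * (real n - real (card G))"
    using card_le_unassigned_product[OF finite_atLeastAtMost S(1) sub(2,1,3) disj(3,4)
        img(1,3) uA uG inj(2)]
    by (simp only: S(2) card_atLeastAtMost diff_Suc_1)
  moreover have "real (card G) \<le> (real n - real (card A)) * (real n - real (card B))"
    using card_le_unassigned_product[OF finite_atLeastAtMost finite_atLeastAtMost
        sub(3,1,2) disj(5,6) img(1,2) uA uB inj(3)]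
    by (simp only: S(2) card_atLeastAtMost diff_Suc_1)
  \<comment> \<open>Assigned lines of one kind are distinct and there are \<open>n\<close> of that
    kind. The three bounds together give \<open>D \<ge> 0\<close>, which is needed to take the
    square root.\<close>
  moreover have "card A \<le> n"
    using card_inj_on_le[OF inj_on_private[where h = ?row, OF sub(1) uA]
        subset_trans[OF image_mono[OF sub(1)] img(1)] finite_atLeastAtMost]
    by (simp only: card_atLeastAtMost diff_Suc_1)
  moreover have "card B \<le> n"
    using card_inj_on_le[OF inj_on_private[where h = ?col, OF sub(2) uB]
        subset_trans[OF image_mono[OF sub(2)] img(2)] finite_atLeastAtMost]
    by (simp only: card_atLeastAtMost diff_Suc_1)
  moreover have "card G \<le> n"
    using card_inj_on_le[OF inj_on_private[where h = ?sym, OF sub(3) uG]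
        subset_trans[OF image_mono[OF sub(3)] img(3)] S(1)]
    by (simp only: S(2))
  ultimately have "real (card A) + real (card B) + real (card G)
      \<le> 3 * (real n + 1 / 2 - sqrt (real n + 1 / 4))"
    by (intro sum_le_of_cyclic_products) simp_all
  moreover have "card C = card A + card B + card G"
  proof -
    have "C = A \<union> B \<union> G" using sub unfolding G_def by blast
    moreover have "finite A" "finite B" "finite G" using sub finC finite_subset by blast+
    ultimately show ?thesis
      using disj by (simp add: card_Un_disjoint Int_Un_distrib2)
  qed
  \<comment> \<open>The size of \<open>C\<close> is an integer, so the real bound may be rounded
    down.\<close>
  ultimately show ?thesis by (simp add: le_floor_iff)
qed

end
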